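(* For every signed graph $\Sigma$, $$\mathrm{BSTAB}(\Sigma)\subseteq\mathrm{BTH}(\Sigma)\subseteq\mathrm{BQSTAB}(\Sigma).$$
   Context: Signed graphs. A signed graph is a pair $\Sigma=(G,\sigma)$ with $G$ a finite graph and $\sigma:E(G)\to\{+1,-1\}$. Positive loops are allowed, negative loops are excluded; between two distinct vertices there may be both a positive and a negative edge (a digon); repeated edges of the same sign are immaterial. Convention: every signed graph is replaced by its completion having a positive loop at every vertex. A signed graph is balanced if every cycle has positive sign (product of edge signs; a digon is a negative cycle); a set $B\subseteq V(\Sigma)$ is balanced if the induced signed graph $\Sigma[B]$ is balanced. Conflict graph. $C(\Sigma)$ is the ordinary simple graph on $V(\Sigma)\times\{\pm1\}$ with $(u,s)\sim(v,r)$ iff there is an edge $e=uv$ of $\Sigma$ (possibly a loop, $u=v$) with $r=-\sigma(e)s$. In particular $(v,+)\sim(v,-)$ for all $v$. Ordinary bodies. For a finite simple graph $H$: $\mathrm{STAB}(H)=\operatorname{conv}\{\mathbf 1_I: I\text{ stable in }H\}$; $\mathrm{QSTAB}(H)=\{x\ge0: x(K)\le1\text{ for every clique }K\}$, with $x(K)=\sum_{v\in K}x_v$; $\mathrm{TH}(H)=\{x:\exists\, X\text{ symmetric with }\begin{pmatrix} 1 & x^{\mathsf T} \\ x & X \end{pmatrix}\succeq0,\ \operatorname{diag}X=x,\ X_{uv}=0\ (uv\in E(H))\}$. Signed bodies. Let $p:\mathbb R^{V(\Sigma)\times\{\pm1\}}\to\mathbb R^{V(\Sigma)}$, $p(y)_v=y_{(v,+)}+y_{(v,-)}$.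 Then $\mathrm{BSTAB}(\Sigma)=\operatorname{conv}\{\mathbf 1_B:B\subseteq V(\Sigma)\text{ balanced}\}$, $\mathrm{BTH}(\Sigma)=p(\mathrm{TH}(C(\Sigma)))$, and $\mathrm{BQSTAB}(\Sigma)=p(\mathrm{QSTAB}(C(\Sigma)))$. *)

theory Defs
  imports "HOL-Analysis.Analysis"
begin

text \<open>The two-element group \<open>{+1, -1}\<close>, as a type of class \<open>finite\<close>, so that it can serve
  both as the range of a signature and as part of a coordinate index.\<close>

datatype sgn2 = Plus | Minus

instantiation sgn2 :: "{comm_monoid_mult, uminus, finite}"
begin

definition one_sgn2 :: sgn2 where
  "one_sgn2 = Plus"

fun uminus_sgn2 :: "sgn2 \<Rightarrow> sgn2" where
  "uminus_sgn2 Plus = Minus"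
| "uminus_sgn2 Minus = Plus"

fun times_sgn2 :: "sgn2 \<Rightarrow> sgn2 \<Rightarrow> sgn2" where
  "times_sgn2 Plus s = s"
| "times_sgn2 Minus s = - s"

instance
proof
  fix a b c :: sgn2
  show "a * b * c = a * (b * c)" by (cases a; cases b; cases c) simp_all
  show "a * b = b * a" by (cases a; cases b) simp_all
  show "1 * a = a" by (simp add: one_sgn2_def)
  have "UNIV = {Plus, Minus}" using sgn2.exhaust by blast
  then show "finite (UNIV :: sgn2 set)" by (metis finite.emptyI finite_insert)
qed

end


text \<open>Edges are named (type \<open>'e\<close>), so parallel edges are possible; \<open>ends e\<close> is the set of
  endpoints, a singleton for a loop.\<close>

record ('v, 'e) sgraph =
  verts :: "'v set"
  edges :: "'e set"
  ends  :: "'e \<Rightarrow> 'v set"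
  edge_sign :: "'e \<Rightarrow> sgn2"

definition signed_graph :: "('v, 'e) sgraph \<Rightarrow> bool" where
  "signed_graph \<Sigma> \<longleftrightarrow>
     finite (verts \<Sigma>) \<and> finite (edges \<Sigma>) \<and>
     (\<forall>e\<in>edges \<Sigma>. ends \<Sigma> e \<subseteq> verts \<Sigma> \<and> card (ends \<Sigma> e) \<in> {1, 2} \<and>
        (card (ends \<Sigma> e) = 1 \<longrightarrow> edge_sign \<Sigma> e = 1))"

text \<open>The new edge \<open>Inr v\<close> is a positive loop at \<open>v\<close>.\<close>

definition sg_completion :: "('v, 'e) sgraph \<Rightarrow> ('v, 'e + 'v) sgraph" where
  "sg_completion \<Sigma> =
     \<lparr>verts = verts \<Sigma>,
      edges = Inl ` edges \<Sigma> \<union> Inr ` verts \<Sigma>,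
      ends = (\<lambda>e. case e of Inl e' \<Rightarrow> ends \<Sigma> e' | Inr v \<Rightarrow> {v}),
      edge_sign = (\<lambda>e. case e of Inl e' \<Rightarrow> edge_sign \<Sigma> e' | Inr v \<Rightarrow> 1)\<rparr>"

definition induced :: "('v, 'e) sgraph \<Rightarrow> 'v set \<Rightarrow> ('v, 'e) sgraph" where
  "induced \<Sigma> B = \<Sigma>\<lparr>verts := B, edges := {e \<in> edges \<Sigma>. ends \<Sigma> e \<subseteq> B}\<rparr>"

text \<open>Length 1 gives loops and length 2 gives pairs of distinct parallel edges (digons).\<close>

definition cycle :: "('v, 'e) sgraph \<Rightarrow> 'v list \<Rightarrow> 'e list \<Rightarrow> bool" where
  "cycle \<Sigma> vs es \<longleftrightarrow>
     vs \<noteq> [] \<and> length es = length vs \<and> distinct vs \<and> distinct es \<and>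
     set vs \<subseteq> verts \<Sigma> \<and> set es \<subseteq> edges \<Sigma> \<and>
     (\<forall>i<length vs. ends \<Sigma> (es ! i) = {vs ! i, vs ! (Suc i mod length vs)})"

definition balanced :: "('v, 'e) sgraph \<Rightarrow> bool" where
  "balanced \<Sigma> \<longleftrightarrow> (\<forall>vs es. cycle \<Sigma> vs es \<longrightarrow> prod_list (map (edge_sign \<Sigma>) es) = 1)"

definition balanced_set :: "('v, 'e) sgraph \<Rightarrow> 'v set \<Rightarrow> bool" where
  "balanced_set \<Sigma> B \<longleftrightarrow> B \<subseteq> verts \<Sigma> \<and> balanced (induced \<Sigma> B)"

lemma signed_graph_sg_completion: "signed_graph \<Sigma> \<Longrightarrow> signed_graph (sg_completion \<Sigma>)"
  by (simp add: signed_graph_def sg_completion_def ball_Un)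


record 'a graph =
  gverts :: "'a set"
  gedges :: "'a set set"

definition simple_graph :: "'a graph \<Rightarrow> bool" where
  "simple_graph H \<longleftrightarrow>
     finite (gverts H) \<and> (\<forall>e\<in>gedges H. e \<subseteq> gverts H \<and> card e = 2)"

definition clique :: "'a graph \<Rightarrow> 'a set \<Rightarrow> bool" where
  "clique H K \<longleftrightarrow> K \<subseteq> gverts H \<and> (\<forall>u\<in>K. \<forall>v\<in>K. u \<noteq> v \<longrightarrow> {u, v} \<in> gedges H)"

definition conflict_graph :: "('v, 'e) sgraph \<Rightarrow> ('v \<times> sgn2) graph" where
  "conflict_graph \<Sigma> =
     \<lparr>gverts = verts \<Sigma> \<times> UNIV,
      gedges = {{(u, s), (v, r)} | u v s r.
                  \<exists>e\<in>edges \<Sigma>. ends \<Sigma> e = {u, v} \<and> r = - edge_sign \<Sigma> e * s}\<rparr>"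

lemma simple_conflict_graph:
  assumes "signed_graph \<Sigma>"
  shows "simple_graph (conflict_graph \<Sigma>)"
proof -
  have ne: "(u, s) \<noteq> (v, - edge_sign \<Sigma> e * s)"
    if "e \<in> edges \<Sigma>" "ends \<Sigma> e = {u, v}" for e u v s
    using assms that by (cases s) (auto simp: signed_graph_def one_sgn2_def)
  have fin: "finite (verts \<Sigma>)"
    and sub: "\<And>e. e \<in> edges \<Sigma> \<Longrightarrow> ends \<Sigma> e \<subseteq> verts \<Sigma>"
    using assms by (simp_all add: signed_graph_def)
  have "c \<subseteq> verts \<Sigma> \<times> UNIV \<and> card c = 2"
    if c: "c \<in> gedges (conflict_graph \<Sigma>)" for c
  proof -
    from c obtain u v s r e where "c = {(u, s), (v, r)}" "e \<in> edges \<Sigma>"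
      "ends \<Sigma> e = {u, v}" "r = - edge_sign \<Sigma> e * s"
      unfolding conflict_graph_def by auto
    then show ?thesis
      using ne[of e u v s] sub[of e] by simp
  qed
  then show ?thesis
    using fin by (simp add: simple_graph_def conflict_graph_def)
qed


text \<open>Vertex sets are subsets \<open>V\<close> of a finite type, which allows \<open>V\<close> to be empty.  The space
  of real vectors indexed by \<open>V\<close> is identified with the coordinate subspace
  \<open>coord_space V\<close> (everything, if \<open>V = UNIV\<close>), and likewise for matrices.\<close>

definition coord_space :: "'a::finite set \<Rightarrow> (real ^ 'a) set" where
  "coord_space V = {x. \<forall>v. v \<notin> V \<longrightarrow> x $ v = 0}"

definition char_vec :: "'a::finite set \<Rightarrow> real ^ 'a" where
  "char_vec B = (\<chi> v. indicator B v)"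

definition psd :: "real ^ 'n ^ 'n \<Rightarrow> bool" where
  "psd A \<longleftrightarrow> transpose A = A \<and> (\<forall>z. 0 \<le> z \<bullet> (A *v z))"

text \<open>The block matrix with first row \<open>(1, x\<^sup>T)\<close> and second row \<open>(x, X)\<close>;
  \<open>None\<close> is the extra index.\<close>

definition bordered :: "real ^ 'a ^ 'a \<Rightarrow> real ^ 'a \<Rightarrow> real ^ ('a::finite option) ^ ('a option)" where
  "bordered X x =
     (\<chi> i j. case i of
        None \<Rightarrow> (case j of None \<Rightarrow> 1 | Some v \<Rightarrow> x $ v)
      | Some u \<Rightarrow> (case j of None \<Rightarrow> x $ u | Some v \<Rightarrow> X $ u $ v))"

definition QSTAB :: "'a::finite graph \<Rightarrow> (real ^ 'a) set" where
  "QSTAB H = {x \<in> coord_space (gverts H).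
     (\<forall>v\<in>gverts H. 0 \<le> x $ v) \<and> (\<forall>K. clique H K \<longrightarrow> (\<Sum>v\<in>K. x $ v) \<le> 1)}"

definition TH :: "'a::finite graph \<Rightarrow> (real ^ 'a) set" where
  "TH H = {x \<in> coord_space (gverts H).
     \<exists>X :: real ^ 'a ^ 'a.
       (\<forall>u v. u \<notin> gverts H \<or> v \<notin> gverts H \<longrightarrow> X $ u $ v = 0) \<and>
       transpose X = X \<and>
       psd (bordered X x) \<and>
       (\<forall>v\<in>gverts H. X $ v $ v = x $ v) \<and>
       (\<forall>u v. {u, v} \<in> gedges H \<longrightarrow> X $ u $ v = 0)}"

definition sign_sum :: "real ^ ('v::finite \<times> sgn2) \<Rightarrow> real ^ 'v" where
  "sign_sum y = (\<chi> v. y $ (v, Plus) + y $ (v, Minus))"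

definition BSTAB :: "('v::finite, 'e) sgraph \<Rightarrow> (real ^ 'v) set" where
  "BSTAB \<Sigma> = convex hull (char_vec ` {B. balanced_set \<Sigma> B})"

definition BTH :: "('v::finite, 'e) sgraph \<Rightarrow> (real ^ 'v) set" where
  "BTH \<Sigma> = sign_sum ` TH (conflict_graph \<Sigma>)"

definition BQSTAB :: "('v::finite, 'e) sgraph \<Rightarrow> (real ^ 'v) set" where
  "BQSTAB \<Sigma> = sign_sum ` QSTAB (conflict_graph \<Sigma>)"

end

theory Submission
  imports Defs
begin

text \<open>
  A balanced set \<open>B\<close> carries a switching function \<open>t : B \<rightarrow> {+1, -1}\<close> with
  \<open>\<sigma>(uv) = t(u) t(v)\<close> (Harary): otherwise some vertex is joined to its antipode in the signed
  double cover, and a shortest such path projects to a negative cycle.  The set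
  \<open>{(v, t v) | v \<in> B}\<close> is then stable in the conflict graph and projects onto \<open>B\<close>; since the
  theta body is convex and contains the indicators of stable sets, the first inclusion follows.
  The second one is the inequality \<open>TH \<subseteq> QSTAB\<close>, obtained by testing the bordered matrix
  against \<open>(1, -1\<^sub>K)\<close> for a clique \<open>K\<close>.
\<close>

section \<open>Arithmetic in the two-element sign group\<close>

lemma uminus_sgn2_neq [simp]: "- (s::sgn2) \<noteq> s" "s \<noteq> - s"
  by (cases s; simp)+

lemma sgn2_neq_iff: "(s::sgn2) \<noteq> r \<longleftrightarrow> s = - r"
  by (cases s; cases r) auto

lemma uminus_times_sgn2: "- (s::sgn2) * r = - (s * r)"
  by (cases s; cases r) auto

lemma sgn2_square_cancel [simp]: "(s::sgn2) * (s * r) = r"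
  by (cases s; cases r) auto

subsection \<open>Switching functions of balanced signed graphs\<close>

text \<open>The second coordinate records the sign of the walk so far. The adjacency of
  \<open>conflict_graph\<close> is this one with the new sign negated.\<close>

definition double_cover :: "('v, 'e) sgraph \<Rightarrow> (('v \<times> sgn2) \<times> ('v \<times> sgn2)) set" where
  "double_cover \<Sigma> =
     {((u, s), (v, r)). \<exists>e\<in>edges \<Sigma>. ends \<Sigma> e = {u, v} \<and> r = edge_sign \<Sigma> e * s}"

lemma sym_double_cover: "sym (double_cover \<Sigma>)"
  by (rule symI) (auto simp: double_cover_def insert_commute)

lemma balanced_no_antipodal_path:
  assumes wf: "\<And>e. e \<in> edges \<Sigma> \<Longrightarrow> ends \<Sigma> e \<subseteq> verts \<Sigma>"
    and bal: "balanced \<Sigma>"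
  shows "((v, s), (v, - s)) \<notin> (double_cover \<Sigma>)\<^sup>*"
proof
  let ?R = "double_cover \<Sigma>"
  \<comment> \<open>The length is minimised over all base points and signs, so that a shorter
    antipodal path starting elsewhere is also a contradiction.\<close>
  let ?P = "\<lambda>n. \<exists>v s. ((v, s), (v, - s)) \<in> ?R ^^ n"
  assume "((v, s), (v, - s)) \<in> ?R\<^sup>*"
  then have ex: "\<exists>n. ?P n"
    by (meson rtrancl_imp_relpow)
  define n where "n = (LEAST n. ?P n)"
  have "?P n"
    unfolding n_def using ex by (rule LeastI_ex)
  have minimal: "\<not> ?P m" if "m < n" for m
    using that not_less_Least unfolding n_def by blast
  obtain v s where "((v, s), (v, - s)) \<in> ?R ^^ n"
    using \<open>?P n\<close> by blast
  then obtain f where f0: "f 0 = (v, s)" and fn: "f n = (v, - s)"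
    and step: "\<And>i. i < n \<Longrightarrow> (f i, f (Suc i)) \<in> ?R"
    by (auto simp: relpow_fun_conv)
  have path: "(f i, f j) \<in> ?R ^^ (j - i)" if "i \<le> j" "j \<le> n" for i j
    unfolding relpow_fun_conv
    by (rule exI[of _ "\<lambda>k. f (i + k)"]) (use that step in auto)
  \<comment> \<open>Suppose a vertex repeats. With equal signs, the detour between the two visits
    can be cut out; with opposite signs, the detour is itself a shorter antipodal path.\<close>
  have inj: "fst (f i) \<noteq> fst (f j)" if ij: "i < j" "j < n" for i j
  proof
    assume eq: "fst (f i) = fst (f j)"
    show False
    proof (cases "f i = f j")
      case True
      have "(f 0, f i) \<in> ?R ^^ i" "(f j, f n) \<in> ?R ^^ (n - j)"
        using path[of 0 i] path[of j n] ij by auto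
      then have "(f 0, f n) \<in> ?R ^^ (i + (n - j))"
        using True by (auto simp: relpow_add)
      then have "?P (i + (n - j))"
        using f0 fn by auto
      moreover have "i + (n - j) < n"
        using ij by simp
      ultimately show False
        using minimal by blast
    next
      case False
      then have "f j = (fst (f i), - snd (f i))"
        using eq by (metis prod.collapse sgn2_neq_iff)
      then have "?P (j - i)"
        using path[of i j] ij by (metis less_imp_le prod.collapse)
      moreover have "j - i < n"
        using ij by simp
      ultimately show False
        using minimal by blast
    qed
  qed
  have "n > 0"
    using f0 fn by (cases n) auto
  define w where "w i = fst (f i)" for i
  have wn: "w n = w 0"
    using f0 fn by (simp add: w_def)
  have w_inj: "i = j" if "w i = w j" "i < n" "j < n" for i j
    using inj[of i j] inj[of j i] that by (metis nat_neq_iff w_def)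
  have "\<forall>i<n. \<exists>e\<in>edges \<Sigma>. ends \<Sigma> e = {w i, w (Suc i)} \<and>
      snd (f (Suc i)) = edge_sign \<Sigma> e * snd (f i)"
    using step by (force simp: double_cover_def w_def split: prod.splits)
  then obtain e where e: "\<And>i. i < n \<Longrightarrow> e i \<in> edges \<Sigma>"
    and ends: "\<And>i. i < n \<Longrightarrow> ends \<Sigma> (e i) = {w i, w (Suc i)}"
    and sign: "\<And>i. i < n \<Longrightarrow> snd (f (Suc i)) = edge_sign \<Sigma> (e i) * snd (f i)"
    by metis
  \<comment> \<open>A repeated edge must be traversed back and forth, and injectivity of
    \<open>w\<close> then leaves only \<open>n = 2\<close>. Its sign cancels, so the path would end
    at \<open>(v, s)\<close>.\<close>
  have e_inj: "e i \<noteq> e j" if ij: "i < j" "j < n" for i j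
  proof
    assume eq: "e i = e j"
    have "w i \<noteq> w j"
      using w_inj[of i j] ij by auto
    moreover have "{w i, w (Suc i)} = {w j, w (Suc j)}"
      using ends[of i] ends[of j] eq ij by simp
    ultimately have "w i = w (Suc j)" "w j = w (Suc i)"
      by (auto simp: doubleton_eq_iff)
    have "j = Suc i"
      using w_inj[of j "Suc i"] \<open>w j = w (Suc i)\<close> ij by auto
    have "Suc j = n"
      using w_inj[of i "Suc j"] \<open>w i = w (Suc j)\<close> ij by (cases "Suc j = n") auto
    then have "i = 0"
      using w_inj[of i 0] \<open>w i = w (Suc j)\<close> wn ij by auto
    have "snd (f n) = edge_sign \<Sigma> (e j) * (edge_sign \<Sigma> (e i) * snd (f 0))"
      using sign ij \<open>Suc j = n\<close> \<open>i = 0\<close> \<open>j = Suc i\<close> by (metis less_trans)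
    then show False
      using eq f0 fn by simp
  qed
  let ?vs = "map w [0..<n]" and ?es = "map e [0..<n]"
  have "cycle \<Sigma> ?vs ?es"
    unfolding cycle_def
  proof (intro conjI)
    show "distinct ?vs"
      using w_inj by (auto simp: distinct_map inj_on_def)
    show "distinct ?es"
      using e_inj by (auto simp: distinct_map inj_on_def) (metis nat_neq_iff)
    show "set ?vs \<subseteq> verts \<Sigma>"
      using ends e wf by fastforce
    have "w (Suc i mod n) = w (Suc i)" if "i < n" for i
      using that wn by (cases "Suc i = n") auto
    then show "\<forall>i<length ?vs. ends \<Sigma> (?es ! i) = {?vs ! i, ?vs ! (Suc i mod length ?vs)}"
      using ends \<open>n > 0\<close> by auto
  qed (use e \<open>n > 0\<close> in auto)
  then have "prod_list (map (edge_sign \<Sigma>) ?es) = 1"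
    using bal unfolding balanced_def by blast
  \<comment> \<open>At \<open>k = n\<close> the product is 1 by balance, which contradicts the
    endpoint \<open>(v, - s)\<close>.\<close>
  moreover have "snd (f k) = prod_list (map (edge_sign \<Sigma>) (map e [0..<k])) * s" if "k \<le> n" for k
    using that
  proof (induction k)
    case 0
    then show ?case using f0 by simp
  next
    case (Suc k)
    then show ?case using sign[of k] by (simp add: ac_simps)
  qed
  ultimately have "snd (f n) = s"
    by (metis le_refl mult_1)
  then show False
    using fn by simp
qed

text \<open>Root each component and let \<open>t v\<close> be the sign of a walk from the root to
  \<open>v\<close>. Without antipodal paths, all such walks have the same sign.\<close>

lemma balanced_switching_function:
  assumes wf: "\<And>e. e \<in> edges \<Sigma> \<Longrightarrow> ends \<Sigma> e \<subseteq> verts \<Sigma>"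
    and bal: "balanced \<Sigma>"
  obtains t where
    "\<And>e u v. e \<in> edges \<Sigma> \<Longrightarrow> ends \<Sigma> e = {u, v} \<Longrightarrow> t v = edge_sign \<Sigma> e * t u"
proof -
  let ?R = "double_cover \<Sigma>"
  define component where "component v = {u. \<exists>s. ((u, Plus), (v, s)) \<in> ?R\<^sup>*}" for v
  \<comment> \<open>The choice depends on \<open>v\<close> only through the set
    \<open>component v\<close>, so adjacent vertices get the same root.\<close>
  define root where "root v = (SOME u. u \<in> component v)" for v
  define t where "t v = (SOME s. ((root v, Plus), (v, s)) \<in> ?R\<^sup>*)" for v
  have root: "root v \<in> component v" for v
    unfolding root_def by (rule someI[of _ v]) (auto simp: component_def)
  have t: "((root v, Plus), (v, t v)) \<in> ?R\<^sup>*" for v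
    using root[of v] unfolding t_def component_def by (auto intro: someI)
  have sym_rtrancl: "(q, p) \<in> ?R\<^sup>*" if "(p, q) \<in> ?R\<^sup>*" for p q
    using that sym_double_cover by (metis sym_rtrancl symD)
  have "t v = edge_sign \<Sigma> e * t u" if e: "e \<in> edges \<Sigma>" "ends \<Sigma> e = {u, v}" for e u v
  proof -
    have edge: "((u, s), (v, edge_sign \<Sigma> e * s)) \<in> ?R"
      "((v, s), (u, edge_sign \<Sigma> e * s)) \<in> ?R" for s
      using e by (auto simp: double_cover_def insert_commute)
    have "component u = component v"
      unfolding component_def using edge by (blast intro: rtrancl_into_rtrancl)
    then have "root u = root v"
      by (simp add: root_def)
    then have "((root v, Plus), (v, edge_sign \<Sigma> e * t u)) \<in> ?R\<^sup>*"
      using t[of u] edge(1) by (metis rtrancl_into_rtrancl)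
    \<comment> \<open>Both lifts of \<open>v\<close> are reachable from the same root; if they
      differed, they would be antipodal.\<close>
    then have "((v, t v), (v, edge_sign \<Sigma> e * t u)) \<in> ?R\<^sup>*"
      using sym_rtrancl[OF t[of v]] by (rule rtrancl_trans[rotated])
    then show ?thesis
      using balanced_no_antipodal_path[OF wf bal, of v "t v"] by (metis sgn2_neq_iff)
  qed
  then show thesis
    by (rule that)
qed

subsection \<open>The theta body\<close>

lemma sum_option_UNIV:
  fixes g :: "'a::finite option \<Rightarrow> real"
  shows "sum g UNIV = g None + (\<Sum>v\<in>UNIV. g (Some v))"
  by (simp add: UNIV_option_conv sum.reindex)

lemma bordered_quadratic_form:
  fixes z :: "real ^ ('a::finite option)"
  shows "z \<bullet> (bordered X x *v z) =
    z $ None * z $ None + 2 * z $ None * (\<Sum>v\<in>UNIV. x $ v * z $ Some v)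
      + (\<Sum>u\<in>UNIV. \<Sum>v\<in>UNIV. z $ Some u * X $ u $ v * z $ Some v)"
  by (simp add: inner_vec_def matrix_vector_mult_def bordered_def sum_option_UNIV
      algebra_simps sum.distrib sum_distrib_left)

lemma transpose_bordered:
  assumes "transpose X = X"
  shows "transpose (bordered X x) = bordered X x"
proof -
  have "X $ u $ v = X $ v $ u" for u v
    using assms by (metis transpose_def vec_lambda_beta)
  then show ?thesis
    by (auto simp: vec_eq_iff transpose_def bordered_def split: option.splits)
qed

lemma psd_bordered_iff:
  assumes "transpose X = X"
  shows "psd (bordered X x) \<longleftrightarrow> (\<forall>z. 0 \<le> z \<bullet> (bordered X x *v z))"
  using transpose_bordered[OF assms] by (simp add: psd_def)

text \<open>The corner entry is the constant 1, which is why the weights must sum to 1; all other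
  entries are linear in the data.\<close>

lemma bordered_convex_combination:
  assumes "a + b = (1::real)"
  shows "bordered (a *\<^sub>R X + b *\<^sub>R Y) (a *\<^sub>R x + b *\<^sub>R y) =
    a *\<^sub>R bordered X x + b *\<^sub>R bordered Y y"
  using assms by (auto simp: vec_eq_iff bordered_def split: option.splits)

lemma psd_nonneg_combination:
  assumes "psd A" "psd B" "0 \<le> a" "0 \<le> b"
  shows "psd (a *\<^sub>R A + b *\<^sub>R B)"
  unfolding psd_def
proof (intro conjI allI)
  have "A $ i $ j = A $ j $ i" "B $ i $ j = B $ j $ i" for i j
    using assms unfolding psd_def by (metis transpose_def vec_lambda_beta)+
  then show "transpose (a *\<^sub>R A + b *\<^sub>R B) = a *\<^sub>R A + b *\<^sub>R B"
    by (simp add: vec_eq_iff transpose_def)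
next
  fix z
  have "z \<bullet> ((a *\<^sub>R A + b *\<^sub>R B) *v z) = a * (z \<bullet> (A *v z)) + b * (z \<bullet> (B *v z))"
    by (simp add: matrix_vector_mult_add_rdistrib inner_add_right
        scaleR_matrix_vector_assoc[symmetric])
  then show "0 \<le> z \<bullet> ((a *\<^sub>R A + b *\<^sub>R B) *v z)"
    using assms by (simp add: psd_def)
qed

text \<open>The same combination of the two witness matrices works: zero pattern, diagonal and
  symmetry are linear conditions, and psd matrices form a convex cone.\<close>

lemma convex_TH: "convex (TH H)"
proof (rule convexI)
  fix x y :: "real ^ 'a" and a b :: real
  assume x: "x \<in> TH H" and y: "y \<in> TH H" and ab: "0 \<le> a" "0 \<le> b" "a + b = 1"
  obtain X where X: "\<forall>u v. u \<notin> gverts H \<or> v \<notin> gverts H \<longrightarrow> X $ u $ v = 0"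
    "transpose X = X" "psd (bordered X x)" "\<forall>v\<in>gverts H. X $ v $ v = x $ v"
    "\<forall>u v. {u, v} \<in> gedges H \<longrightarrow> X $ u $ v = 0"
    using x by (auto simp: TH_def)
  obtain Y where Y: "\<forall>u v. u \<notin> gverts H \<or> v \<notin> gverts H \<longrightarrow> Y $ u $ v = 0"
    "transpose Y = Y" "psd (bordered Y y)" "\<forall>v\<in>gverts H. Y $ v $ v = y $ v"
    "\<forall>u v. {u, v} \<in> gedges H \<longrightarrow> Y $ u $ v = 0"
    using y by (auto simp: TH_def)
  let ?Z = "a *\<^sub>R X + b *\<^sub>R Y"
  have "a *\<^sub>R x + b *\<^sub>R y \<in> coord_space (gverts H)"
    using x y by (auto simp: TH_def coord_space_def)
  moreover have "transpose ?Z = ?Z"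
    using X(2) Y(2) by (simp add: vec_eq_iff transpose_def)
  moreover have "psd (bordered ?Z (a *\<^sub>R x + b *\<^sub>R y))"
    using psd_nonneg_combination[OF X(3) Y(3) ab(1,2)]
    by (simp add: bordered_convex_combination[OF ab(3)])
  ultimately show "a *\<^sub>R x + b *\<^sub>R y \<in> TH H"
    unfolding TH_def using X(1,4,5) Y(1,4,5) by (auto intro!: exI[of _ ?Z])
qed

text \<open>The witness is the rank-one matrix \<open>x x^T\<close>: bordering it gives
  \<open>(1,x)(1,x)^T\<close>, whose form is a square. Its diagonal is \<open>x\<close> because
  entries are 0 or 1.\<close>

lemma char_vec_stable_in_TH:
  assumes sub: "I \<subseteq> gverts H"
    and stable: "\<And>u v. {u, v} \<in> gedges H \<Longrightarrow> \<not> {u, v} \<subseteq> I"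
  shows "char_vec I \<in> TH H"
proof -
  let ?x = "char_vec I"
  let ?X = "(\<chi> u v. ?x $ u * ?x $ v) :: real ^ 'a ^ 'a"
  have sym: "transpose ?X = ?X"
    by (simp add: vec_eq_iff transpose_def mult.commute)
  have "z \<bullet> (bordered ?X ?x *v z) = (z $ None + (\<Sum>v\<in>UNIV. ?x $ v * z $ Some v))\<^sup>2" for z
  proof -
    have "(\<Sum>u\<in>UNIV. \<Sum>v\<in>UNIV. z $ Some u * ?X $ u $ v * z $ Some v) =
        (\<Sum>v\<in>UNIV. ?x $ v * z $ Some v)\<^sup>2"
      by (simp add: power2_eq_square sum_product ac_simps)
    then show ?thesis
      unfolding bordered_quadratic_form by (simp add: power2_eq_square algebra_simps)
  qed
  then have "psd (bordered ?X ?x)"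
    by (simp add: psd_bordered_iff[OF sym])
  moreover have "?x \<in> coord_space (gverts H)"
    using sub by (auto simp: coord_space_def char_vec_def indicator_def)
  ultimately show ?thesis
    unfolding TH_def using sym sub stable
    by (auto intro!: exI[of _ ?X] simp: char_vec_def indicator_def)
qed

lemma TH_subset_QSTAB: "TH H \<subseteq> QSTAB H"
proof
  fix x assume "x \<in> TH H"
  then obtain X where x: "x \<in> coord_space (gverts H)"
    and sym: "transpose X = X" and psd: "psd (bordered X x)"
    and diag: "\<And>v. v \<in> gverts H \<Longrightarrow> X $ v $ v = x $ v"
    and edge: "\<And>u v. {u, v} \<in> gedges H \<Longrightarrow> X $ u $ v = 0"
    by (auto simp: TH_def)
  \<comment> \<open>Off-diagonal entries of \<open>X\<close> vanish on a clique, so the form reduces to the diagonal.\<close>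
  have form: "0 \<le> c * c + 2 * c * d * sum (($) x) K + d * d * sum (($) x) K"
    if K: "clique H K" for c d K
  proof -
    let ?z = "(\<chi> i. case i of None \<Rightarrow> c | Some v \<Rightarrow> if v \<in> K then d else 0) :: real ^ 'a option"
    have lin: "(\<Sum>v\<in>UNIV. x $ v * ?z $ Some v) = d * sum (($) x) K"
      by (simp add: if_distrib sum.If_cases sum_distrib_left mult.commute cong: if_cong)
    have "(\<Sum>v\<in>UNIV. ?z $ Some u * X $ u $ v * ?z $ Some v) = (if u \<in> K then d * d * x $ u else 0)"
      for u
    proof (cases "u \<in> K")
      case True
      have "?z $ Some u * X $ u $ v * ?z $ Some v = (if v = u then d * d * x $ u else 0)" for v
        using True K edge[of u v] diag[of u] by (auto simp: clique_def)
      then show ?thesis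
        using True by simp
    qed simp
    then have "(\<Sum>u\<in>UNIV. \<Sum>v\<in>UNIV. ?z $ Some u * X $ u $ v * ?z $ Some v) =
        d * d * sum (($) x) K"
      by (simp add: sum.If_cases sum_distrib_left)
    then have "?z \<bullet> (bordered X x *v ?z) =
        c * c + 2 * c * d * sum (($) x) K + d * d * sum (($) x) K"
      unfolding bordered_quadratic_form lin by simp
    then show ?thesis
      using psd unfolding psd_def by metis
  qed
  \<comment> \<open>A single vertex is a clique; \<open>c = 0\<close>, \<open>d = 1\<close> isolates
    its diagonal entry.\<close>
  have "0 \<le> x $ v" if "v \<in> gverts H" for v
    using form[of "{v}" 0 1] that by (simp add: clique_def)
  \<comment> \<open>For \<open>c = 1\<close>, \<open>d = -1\<close> the form is
    \<open>1 - 2 x(K) + x(K) = 1 - x(K)\<close>.\<close>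
  moreover have "(\<Sum>v\<in>K. x $ v) \<le> 1" if "clique H K" for K
    using form[OF that, of 1 "- 1"] by simp
  ultimately show "x \<in> QSTAB H"
    using x by (simp add: QSTAB_def)
qed

subsection \<open>Signed bodies\<close>

lemma linear_sign_sum: "linear sign_sum"
  by (rule linearI) (simp_all add: sign_sum_def vec_eq_iff algebra_simps)

lemma char_vec_balanced_in_BTH:
  assumes "balanced_set \<Sigma> B"
  shows "char_vec B \<in> BTH \<Sigma>"
proof -
  have B: "B \<subseteq> verts \<Sigma>" and bal: "balanced (induced \<Sigma> B)"
    using assms by (auto simp: balanced_set_def)
  have wf: "ends (induced \<Sigma> B) e \<subseteq> verts (induced \<Sigma> B)" if "e \<in> edges (induced \<Sigma> B)" for e
    using that by (simp add: induced_def)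
  obtain t where "\<And>e u v. e \<in> edges (induced \<Sigma> B) \<Longrightarrow> ends (induced \<Sigma> B) e = {u, v} \<Longrightarrow>
      t v = edge_sign (induced \<Sigma> B) e * t u"
    using balanced_switching_function[OF wf bal] by blast
  then have t: "t v = edge_sign \<Sigma> e * t u"
    if "e \<in> edges \<Sigma>" "ends \<Sigma> e = {u, v}" "u \<in> B" "v \<in> B" for e u v
    using that by (auto simp: induced_def)
  let ?I = "{(v, t v) | v. v \<in> B}"
  have "\<not> {p, q} \<subseteq> ?I" if pq: "{p, q} \<in> gedges (conflict_graph \<Sigma>)" for p q
  proof
    assume sub: "{p, q} \<subseteq> ?I"
    obtain u v s e where e: "{p, q} = {(u, s), (v, - edge_sign \<Sigma> e * s)}"
      "e \<in> edges \<Sigma>" "ends \<Sigma> e = {u, v}"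
      using pq by (auto simp: conflict_graph_def)
    \<comment> \<open>A conflict edge inside \<open>?I\<close> would give \<open>t v\<close> the
      sign opposite to the one the switching identity prescribes.\<close>
    then have "u \<in> B" "v \<in> B" "s = t u" "- edge_sign \<Sigma> e * s = t v"
      using sub by auto
    then show False
      using t[OF e(2,3)] by (metis uminus_sgn2_neq uminus_times_sgn2)
  qed
  moreover have "?I \<subseteq> gverts (conflict_graph \<Sigma>)"
    using B by (auto simp: conflict_graph_def)
  ultimately have "char_vec ?I \<in> TH (conflict_graph \<Sigma>)"
    by (intro char_vec_stable_in_TH) auto
  \<comment> \<open>Exactly one of the two copies of each vertex of \<open>B\<close> lies in
    \<open>?I\<close>, and no copy of any other vertex does.\<close>
  moreover have "char_vec B $ v = sign_sum (char_vec ?I) $ v" for v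
    by (cases "t v") (auto simp: sign_sum_def char_vec_def indicator_def)
  then have "char_vec B = sign_sum (char_vec ?I)"
    by (simp add: vec_eq_iff)
  ultimately show ?thesis
    by (auto simp: BTH_def)
qed

text \<open>A linear image of a convex set is convex, so only the generators of the hull need
  checking.\<close>

lemma BSTAB_subset_BTH: "BSTAB \<Sigma> \<subseteq> BTH \<Sigma>"
  unfolding BSTAB_def
proof (rule hull_minimal)
  show "char_vec ` {B. balanced_set \<Sigma> B} \<subseteq> BTH \<Sigma>"
    using char_vec_balanced_in_BTH by auto
  show "convex (BTH \<Sigma>)"
    unfolding BTH_def by (rule convex_linear_image[OF linear_sign_sum convex_TH])
qed

lemma BTH_subset_BQSTAB: "BTH \<Sigma> \<subseteq> BQSTAB \<Sigma>"
  unfolding BTH_def BQSTAB_def by (rule image_mono[OF TH_subset_QSTAB])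

theorem mainTheorem4:
  fixes \<Sigma> :: "('v::finite, 'e) sgraph"
  assumes "signed_graph \<Sigma>"
  shows "BSTAB (sg_completion \<Sigma>) \<subseteq> BTH (sg_completion \<Sigma>) \<and>
         BTH (sg_completion \<Sigma>) \<subseteq> BQSTAB (sg_completion \<Sigma>)"
  using BSTAB_subset_BTH BTH_subset_BQSTAB by blast

end
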